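(* Let $(S,\mathfrak{S},\mu)$ and $(T,\mathfrak{T},\nu)$ be arbitrary measure spaces. There exists a unique measure $\mu\otimes\nu$ in $(S\times T,\mathfrak{S}\otimes\mathfrak{T})$ such that $$(\mu\otimes\nu)^\sigma=\mu^\sigma\otimes\nu^\sigma,$$ i.e. whose $\sigma$-finite component is the product of the $\sigma$-finite components of $\mu$ and $\nu$. Moreover, this measure $\mu\otimes\nu$ is the only measure in $(S\times T,\mathfrak{S}\otimes\mathfrak{T})$ which has the following two properties: (i) $(\mu\otimes\nu)(A\times B)=\mu(A)\cdot\nu(B)$ for any $A\in\mathfrak{S}_\mu^{\mathrm f}$, $B\in\mathfrak{T}_\nu^{\mathrm f}$; (ii) the $\sigma$-ring $(\mathfrak{S}\otimes\mathfrak{T})_{\mu\otimes\nu}^\sigma$ of all $\sigma$-finite sets in $\mathfrak{S}\otimes\mathfrak{T}$ is generated (as a $\sigma$-ring) by the family $\{A\times B:\ A\in\mathfrak{S}_\mu^{\mathrm f},\ B\in\mathfrak{T}_\nu^{\mathrm f}\}$.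
   Context: A $\sigma$-ring is a family of sets (containing $\emptyset$) closed under countable unions and under differences $A\setminus B$. A measurable space is a pair $(S,\mathfrak{S})$ with $S$ a nonempty set and $\mathfrak{S}$ a $\sigma$-ring of subsets of $S$ ($S\in\mathfrak{S}$ is not required). A measure in $(S,\mathfrak{S})$ is a $\sigma$-additive function $\mu\colon\mathfrak{S}\to[0,\infty]$ with $\mu(\emptyset)=0$; then $(S,\mathfrak{S},\mu)$ is a measure space. No $\sigma$-finiteness is assumed. For a measure $\mu$ on $\mathfrak{S}$: $\mathfrak{S}_\mu^{\mathrm f}=\{A\in\mathfrak{S}:\mu(A)<\infty\}$; $\mathfrak{S}_\mu^\sigma$ is the $\sigma$-ring of $\sigma$-finite sets, i.e. of all unions of countable subfamilies of $\mathfrak{S}_\mu^{\mathrm f}$; the $\sigma$-finite component $\mu^\sigma$ of $\mu$ is the restriction of $\mu$ to $\mathfrak{S}_\mu^\sigma$ (a measure with domain $\mathfrak{S}_\mu^\sigma$; equality of $\sigma$-finite components includes equality of domains). For $\sigma$-rings $\mathfrak{S},\mathfrak{T}$, $\mathfrak{S}\otimes\mathfrak{T}$ is the smallest $\sigma$-ring containing $\{A\times B:A\in\mathfrak{S},B\in\mathfrak{T}\}$. The product $\mu^\sigma\otimes\nu^\sigma$ is the classical (Halmos) product of $\sigma$-finite measures: the unique measure on $\mathfrak{S}_\mu^\sigma\otimes\mathfrak{T}_\nu^\sigma$ with $(\mu^\sigma\otimes\nu^\sigma)(A\times B)=\mu(A)\cdot\nu(B)$ for $A\in\mathfrak{S}_\mu^\sigma$,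 $B\in\mathfrak{T}_\nu^\sigma$, with the convention $\infty\cdot0=0$. *)

theory Defs
  imports "HOL-Analysis.Analysis"
begin

definition sigma_ring :: "'a set set \<Rightarrow> bool" where
  "sigma_ring \<SS> \<longleftrightarrow>
     {} \<in> \<SS> \<and>
     (\<forall>A\<in>\<SS>. \<forall>B\<in>\<SS>. A - B \<in> \<SS>) \<and>
     (\<forall>\<A>. countable \<A> \<and> \<A> \<subseteq> \<SS> \<longrightarrow> \<Union>\<A> \<in> \<SS>)"

text \<open>
  Functions with domain \<open>\<SS>\<close> are represented by total functions that are extensional on \<open>\<SS>\<close>
  (equal to \<open>undefined\<close> outside), so that equality of measures on \<open>\<SS>\<close> is HOL equality.
  The library predicate \<^const>\<open>measure_space\<close> is not usable because it demands a sigma-algebra.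
\<close>

definition sigma_ring_measure :: "'a set set \<Rightarrow> ('a set \<Rightarrow> ennreal) \<Rightarrow> bool" where
  "sigma_ring_measure \<SS> \<mu> \<longleftrightarrow>
     \<mu> \<in> extensional \<SS> \<and> positive \<SS> \<mu> \<and> countably_additive \<SS> \<mu>"

definition sigma_ring_measure_space :: "'a set \<Rightarrow> 'a set set \<Rightarrow> ('a set \<Rightarrow> ennreal) \<Rightarrow> bool" where
  "sigma_ring_measure_space S \<SS> \<mu> \<longleftrightarrow>
     S \<noteq> {} \<and> \<SS> \<subseteq> Pow S \<and> sigma_ring \<SS> \<and> sigma_ring_measure \<SS> \<mu>"

definition finite_measure_sets :: "'a set set \<Rightarrow> ('a set \<Rightarrow> ennreal) \<Rightarrow> 'a set set" where
  "finite_measure_sets \<SS> \<mu> = {A \<in> \<SS>. \<mu> A < \<infinity>}"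

definition sigma_finite_sets :: "'a set set \<Rightarrow> ('a set \<Rightarrow> ennreal) \<Rightarrow> 'a set set" where
  "sigma_finite_sets \<SS> \<mu> = {\<Union>\<A> |\<A>. countable \<A> \<and> \<A> \<subseteq> finite_measure_sets \<SS> \<mu>}"

text \<open>
  Pairs of a domain and an extensional function on it: since \<open>undefined\<close> may coincide with an
  attained value, the domain cannot be recovered from the function alone.
\<close>

definition sigma_finite_component ::
    "'a set set \<Rightarrow> ('a set \<Rightarrow> ennreal) \<Rightarrow> 'a set set \<times> ('a set \<Rightarrow> ennreal)" where
  "sigma_finite_component \<SS> \<mu> =
     (sigma_finite_sets \<SS> \<mu>, restrict \<mu> (sigma_finite_sets \<SS> \<mu>))"

definition prod_sigma_ring :: "'a set set \<Rightarrow> 'b set set \<Rightarrow> ('a \<times> 'b) set set" where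
  "prod_sigma_ring \<SS> \<TT> = sigma_ring hull {A \<times> B |A B. A \<in> \<SS> \<and> B \<in> \<TT>}"

text \<open>
  The classical product of two sigma-finite measures, each given together with its domain.
  Multiplication on \<^typ>\<open>ennreal\<close> satisfies \<open>\<infinity> * 0 = 0\<close>.
\<close>

fun halmos_product ::
    "'a set set \<times> ('a set \<Rightarrow> ennreal) \<Rightarrow> 'b set set \<times> ('b set \<Rightarrow> ennreal) \<Rightarrow>
     ('a \<times> 'b) set set \<times> (('a \<times> 'b) set \<Rightarrow> ennreal)" where
  "halmos_product (\<SS>, \<mu>) (\<TT>, \<nu>) =
     (prod_sigma_ring \<SS> \<TT>,
      THE \<rho>. sigma_ring_measure (prod_sigma_ring \<SS> \<TT>) \<rho> \<and>
             (\<forall>A\<in>\<SS>. \<forall>B\<in>\<TT>. \<rho> (A \<times> B) = \<mu> A * \<nu> B))"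

end

theory Submission
  imports Defs
begin

text \<open>
  Let \<open>G\<close> be the \<open>\<sigma>\<close>-ring generated by the rectangles whose sides have finite measure; it is also
  the domain \<open>\<SS>\<^sub>\<mu>\<^sup>\<sigma> \<otimes> \<TT>\<^sub>\<nu>\<^sup>\<sigma>\<close> of the classical product \<open>\<rho>\<^sub>0\<close>
  (\<open>prod_sigma_ring_sigma_finite_sets\<close>). Both descriptions of the product measure fix its values on
  \<open>G\<close> and say that its \<open>\<sigma>\<close>-finite sets are exactly the members of \<open>G\<close>. A measurable set that is
  not \<open>\<sigma>\<close>-finite has measure \<open>\<infinity>\<close>, so at most one measure fits, and the only candidate is \<open>\<rho>\<^sub>0\<close>
  on \<open>G\<close>, continued by \<open>\<infinity>\<close>.

  What has to be seen is that this candidate is \<open>\<sigma>\<close>-additive. It could fail only if a measurable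
  set outside \<open>G\<close> were contained in a set of \<open>G\<close>. This does not happen, because \<open>G\<close> is an ideal of
  \<open>\<SS> \<otimes> \<TT>\<close>: the \<open>\<sigma>\<close>-finite sets are an ideal in each factor, and products of ideals are ideals
  (\<open>sigma_ideal_prod_sigma_ring\<close>). The continuation of a measure from an ideal by \<open>\<infinity>\<close> is always a
  measure (\<open>sigma_ring_measure_infinite_extension\<close>).

  The same continuation reduces the existence of \<open>\<rho>\<^sub>0\<close> to measures on \<open>\<sigma>\<close>-algebras: a \<open>\<sigma>\<close>-ring is
  an ideal in the \<open>\<sigma>\<close>-algebra of its locally measurable sets, and Fubini's construction
  \<open>E \<mapsto> \<integral> \<nu>(E\<^sub>x) d\<mu>(x)\<close> works over a \<open>\<sigma>\<close>-finite part \<open>B\<close> of the second factor,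
  and each set of \<open>G\<close> lies in \<open>S \<times> B\<close> for such a \<open>B\<close> (\<open>halmos_product_measure_exists\<close>). Uniqueness of
  \<open>\<rho>\<^sub>0\<close> is a \<open>\<pi>\<close>-\<open>\<lambda>\<close> argument (\<open>sigma_ring_measure_unique\<close>).
\<close>

section \<open>Sigma-rings and their ideals\<close>

lemma sigma_ring_empty: "sigma_ring R \<Longrightarrow> {} \<in> R"
  and sigma_ring_Diff: "sigma_ring R \<Longrightarrow> A \<in> R \<Longrightarrow> B \<in> R \<Longrightarrow> A - B \<in> R"
  and sigma_ring_Union: "sigma_ring R \<Longrightarrow> countable \<A> \<Longrightarrow> \<A> \<subseteq> R \<Longrightarrow> \<Union>\<A> \<in> R"
  unfolding sigma_ring_def by auto

lemma sigma_ring_UN: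
  assumes "sigma_ring R" "countable I" "\<And>i. i \<in> I \<Longrightarrow> A i \<in> R"
  shows "(\<Union>i\<in>I. A i) \<in> R"
  using sigma_ring_Union[OF assms(1), of "A ` I"] assms by auto

lemma sigma_ring_Int:
  assumes "sigma_ring R" "A \<in> R" "B \<in> R"
  shows "A \<inter> B \<in> R"
  using sigma_ring_Diff[OF assms(1,2) sigma_ring_Diff[OF assms]] by (simp add: Diff_Diff_Int)

lemma sigma_ring_hull: "sigma_ring (sigma_ring hull P)"
  by (rule hull_in) (fastforce simp: sigma_ring_def)

lemma sigma_ring_Collect_Int:
  assumes "sigma_ring R"
  shows "sigma_ring {E. E \<inter> C \<in> R}"
  unfolding sigma_ring_def
proof (intro conjI ballI allI impI CollectI)
  show "{} \<inter> C \<in> R"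
    using assms by (simp add: sigma_ring_empty)
next
  fix A B assume "A \<in> {E. E \<inter> C \<in> R}" "B \<in> {E. E \<inter> C \<in> R}"
  then show "(A - B) \<inter> C \<in> R"
    using sigma_ring_Diff[OF assms, of "A \<inter> C" "B \<inter> C"] by (simp add: Diff_Int_distrib2)
next
  fix \<A> assume "countable \<A> \<and> \<A> \<subseteq> {E. E \<inter> C \<in> R}"
  then have "(\<Union>A\<in>\<A>. A \<inter> C) \<in> R"
    by (intro sigma_ring_UN assms) auto
  then show "\<Union>\<A> \<inter> C \<in> R" by (simp only: Int_Union2)
qed

text \<open>Sets that a countable part of \<open>P\<close> covers already form a \<open>\<sigma>\<close>-ring, so generating adds no
  uncoverable set. This is what replaces the whole space of a \<open>\<sigma>\<close>-algebra.\<close>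

lemma sigma_ring_hull_covered:
  assumes "E \<in> sigma_ring hull P"
  obtains \<A> where "countable \<A>" "\<A> \<subseteq> P" "E \<subseteq> \<Union>\<A>"
proof -
  let ?R = "{E. \<exists>\<A>. countable \<A> \<and> \<A> \<subseteq> P \<and> E \<subseteq> \<Union>\<A>}"
  have "sigma_ring ?R"
    unfolding sigma_ring_def
  proof (intro conjI ballI allI impI)
    show "{} \<in> ?R" by blast
  next
    fix A B assume "A \<in> ?R"
    then show "A - B \<in> ?R" by blast
  next
    fix \<E> assume "countable \<E> \<and> \<E> \<subseteq> ?R"
    then have "countable \<E>" and "\<forall>E\<in>\<E>. \<exists>\<A>. countable \<A> \<and> \<A> \<subseteq> P \<and> E \<subseteq> \<Union>\<A>" by auto
    then obtain f where f: "\<forall>E\<in>\<E>. countable (f E) \<and> f E \<subseteq> P \<and> E \<subseteq> \<Union>(f E)" by metis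
    have "countable (\<Union>(f ` \<E>))" "\<Union>(f ` \<E>) \<subseteq> P" "\<Union>\<E> \<subseteq> \<Union>(\<Union>(f ` \<E>))"
      using f \<open>countable \<E>\<close> by (auto intro: countable_UN) (meson f in_mono UnionE)
    then show "\<Union>\<E> \<in> ?R" by blast
  qed
  moreover have "P \<subseteq> ?R"
  proof
    fix C assume "C \<in> P"
    then show "C \<in> ?R" by (intro CollectI exI[of _ "{C}"]) auto
  qed
  ultimately have "sigma_ring hull P \<subseteq> ?R" by (rule hull_minimal[rotated])
  with assms have "E \<in> ?R" by (rule subsetD[rotated])
  then show thesis using that by auto
qed

text \<open>The term is used as for ideals of Boolean rings: \<open>F \<subseteq> E\<close> means that \<open>F\<close> is the multiple
  \<open>F \<inter> E\<close> of \<open>E\<close>.\<close>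

definition sigma_ideal :: "'a set set \<Rightarrow> 'a set set \<Rightarrow> bool" where
  "sigma_ideal J R \<longleftrightarrow> sigma_ring J \<and> J \<subseteq> R \<and> (\<forall>E\<in>J. \<forall>F\<in>R. F \<subseteq> E \<longrightarrow> F \<in> J)"

lemma sigma_ideal_Int:
  assumes "sigma_ideal J R" "sigma_ring R" "E \<in> J" "F \<in> R"
  shows "F \<inter> E \<in> J"
proof -
  have "F \<inter> E \<in> R"
    using assms by (auto simp: sigma_ideal_def intro: sigma_ring_Int)
  with assms show ?thesis unfolding sigma_ideal_def by blast
qed

lemma sigma_ring_prod_sigma_ring: "sigma_ring (prod_sigma_ring R Q)"
  unfolding prod_sigma_ring_def by (rule sigma_ring_hull)

lemma Times_in_prod_sigma_ring: "A \<in> R \<Longrightarrow> B \<in> Q \<Longrightarrow> A \<times> B \<in> prod_sigma_ring R Q"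
  unfolding prod_sigma_ring_def by (rule hull_inc) blast

lemma prod_sigma_ring_minimal:
  assumes "sigma_ring D" "\<And>A B. A \<in> R \<Longrightarrow> B \<in> Q \<Longrightarrow> A \<times> B \<in> D"
  shows "prod_sigma_ring R Q \<subseteq> D"
  unfolding prod_sigma_ring_def using assms by (intro hull_minimal) auto

text \<open>Cutting down to a rectangle \<open>A \<times> B\<close> with sides in the ideals turns the generators of the large
  product \<open>\<sigma>\<close>-ring into generators of the small one; each set of the small product is covered by
  countably many such rectangles.\<close>

lemma sigma_ideal_prod_sigma_ring:
  assumes J: "sigma_ideal J R" "sigma_ring R" and K: "sigma_ideal K Q" "sigma_ring Q"
  shows "sigma_ideal (prod_sigma_ring J K) (prod_sigma_ring R Q)"
  unfolding sigma_ideal_def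
proof (intro conjI ballI impI)
  show "sigma_ring (prod_sigma_ring J K)" by (rule sigma_ring_prod_sigma_ring)
  show "prod_sigma_ring J K \<subseteq> prod_sigma_ring R Q"
    using J K by (intro prod_sigma_ring_minimal sigma_ring_prod_sigma_ring Times_in_prod_sigma_ring)
      (auto simp: sigma_ideal_def)
next
  fix E F assume E: "E \<in> prod_sigma_ring J K" and F: "F \<in> prod_sigma_ring R Q" "F \<subseteq> E"
  have cut: "F \<inter> (A \<times> B) \<in> prod_sigma_ring J K" if "A \<in> J" "B \<in> K" for A B
  proof -
    have "prod_sigma_ring R Q \<subseteq> {F. F \<inter> (A \<times> B) \<in> prod_sigma_ring J K}"
      using that J K
      by (intro prod_sigma_ring_minimal sigma_ring_Collect_Int sigma_ring_prod_sigma_ring)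
        (auto simp: Times_Int_Times intro!: Times_in_prod_sigma_ring sigma_ideal_Int)
    with F show ?thesis by blast
  qed
  obtain \<A> where \<A>: "countable \<A>" "\<A> \<subseteq> {A \<times> B |A B. A \<in> J \<and> B \<in> K}" "E \<subseteq> \<Union>\<A>"
    using E unfolding prod_sigma_ring_def by (rule sigma_ring_hull_covered)
  have "(\<Union>C\<in>\<A>. F \<inter> C) \<in> prod_sigma_ring J K"
    using \<A>(1,2) cut by (intro sigma_ring_UN sigma_ring_prod_sigma_ring) blast+
  moreover have "(\<Union>C\<in>\<A>. F \<inter> C) = F"
    using \<A>(3) F(2) by blast
  ultimately show "F \<in> prod_sigma_ring J K" by (simp only:)
qed

section \<open>Measures on sigma-rings\<close>

lemma sigma_ring_measure_empty: "sigma_ring_measure R \<mu> \<Longrightarrow> \<mu> {} = 0"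
  by (simp add: sigma_ring_measure_def positive_def)

lemma sigma_ring_measure_suminf:
  assumes "sigma_ring_measure R \<mu>" "sigma_ring R"
    and "\<And>i. A i \<in> R" "disjoint_family A"
  shows "(\<Sum>i. \<mu> (A i)) = \<mu> (\<Union>i. A i)"
  using assms sigma_ring_UN[of R UNIV A]
  by (auto simp: sigma_ring_measure_def countably_additive_def)

lemma sigma_ring_measure_Un:
  assumes "sigma_ring_measure R \<mu>" "sigma_ring R"
    and "A \<in> R" "B \<in> R" "A \<inter> B = {}"
  shows "\<mu> (A \<union> B) = \<mu> A + \<mu> B"
proof -
  have "(\<Sum>i. \<mu> (binaryset A B i)) = \<mu> (\<Union>i. binaryset A B i)"
    using assms by (intro sigma_ring_measure_suminf)
      (auto simp: binaryset_def disjoint_family_on_def sigma_ring_empty)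
  then show ?thesis
    using sigma_ring_measure_empty[OF assms(1)]
    by (simp add: UN_binaryset_eq suminf_binaryset_eq)
qed

lemma sigma_ring_measure_mono:
  assumes "sigma_ring_measure R \<mu>" "sigma_ring R" "A \<in> R" "B \<in> R" "A \<subseteq> B"
  shows "\<mu> A \<le> \<mu> B"
proof -
  have "\<mu> B = \<mu> A + \<mu> (B - A)"
    using sigma_ring_measure_Un[OF assms(1-3), of "B - A"] assms
    by (simp add: sigma_ring_Diff Un_absorb1)
  then show ?thesis by simp
qed

text \<open>The \<open>\<pi>\<close>-\<open>\<lambda>\<close> argument needs a largest set of finite measure, so it is run inside each generator
  \<open>C\<close>, on the \<open>\<sigma>\<close>-algebra of traces on \<open>C\<close>. A general set is cut into countably many disjoint
  pieces, each inside one generator.\<close>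

lemma sigma_ring_measure_unique:
  assumes P: "Int_stable P"
    and \<rho>: "sigma_ring_measure (sigma_ring hull P) \<rho>"
    and \<rho>': "sigma_ring_measure (sigma_ring hull P) \<rho>'"
    and eq: "\<And>C. C \<in> P \<Longrightarrow> \<rho> C = \<rho>' C"
    and fin: "\<And>C. C \<in> P \<Longrightarrow> \<rho> C < \<infinity>"
  shows "\<rho> = \<rho>'"
proof -
  let ?G = "sigma_ring hull P"
  note G = sigma_ring_hull[of P]
  have PG: "C \<in> ?G" if "C \<in> P" for C
    using that by (rule hull_inc)
  have local: "\<rho> E = \<rho>' E" if C: "C \<in> P" and E: "E \<in> ?G" "E \<subseteq> C" for E C
  proof -
    let ?P = "{D \<in> P. D \<subseteq> C}"
    have "Int_stable ?P"
      using P by (auto simp: Int_stable_def)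
    have "?P \<subseteq> Pow C" by auto
    have *: "X \<subseteq> C \<and> X \<in> ?G \<and> \<rho> X = \<rho>' X" if "X \<in> sigma_sets C ?P" for X
      using \<open>Int_stable ?P\<close> \<open>?P \<subseteq> Pow C\<close> that
    proof (induction rule: sigma_sets_induct_disjoint)
      case (basic A)
      then show ?case by (auto simp: eq PG)
    next
      case empty
      then show ?case
        using \<rho> \<rho>' G by (auto simp: sigma_ring_measure_empty sigma_ring_empty)
    next
      case (compl A)
      then have A: "A \<subseteq> C" "A \<in> ?G" "\<rho> A = \<rho>' A" by auto
      have D: "C - A \<in> ?G" using G PG[OF C] A by (simp add: sigma_ring_Diff)
      have CA: "A \<union> (C - A) = C" using A by auto
      have "\<rho> C = \<rho> A + \<rho> (C - A)" "\<rho>' C = \<rho>' A + \<rho>' (C - A)"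
        using sigma_ring_measure_Un[OF \<rho> G A(2) D] sigma_ring_measure_Un[OF \<rho>' G A(2) D] CA
        by auto
      moreover have "\<rho> A < \<infinity>"
        using sigma_ring_measure_mono[OF \<rho> G A(2) PG[OF C] A(1)] fin[OF C] by simp
      ultimately show ?case
        using A eq[OF C] D by (auto simp: ennreal_add_left_cancel)
    next
      case (union A)
      then have "\<And>i. A i \<in> ?G" "disjoint_family A" by auto
      then have "(\<Sum>i. \<rho> (A i)) = \<rho> (\<Union>i. A i)" "(\<Sum>i. \<rho>' (A i)) = \<rho>' (\<Union>i. A i)"
        by (auto intro!: sigma_ring_measure_suminf[OF _ G] \<rho> \<rho>')
      then show ?case
        using union sigma_ring_UN[OF G, of UNIV A] by auto
    qed
    interpret C: sigma_algebra C "sigma_sets C ?P"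
      by (rule sigma_algebra_sigma_sets) auto
    have "sigma_ring (sigma_sets C ?P)"
      unfolding sigma_ring_def by (auto intro: C.Diff C.countable_Union)
    then have "?G \<subseteq> {E. E \<inter> C \<in> sigma_sets C ?P}"
      using P C by (intro hull_minimal sigma_ring_Collect_Int) (auto simp: Int_stable_def)
    with E have "E \<in> sigma_sets C ?P" by (auto simp: Int_absorb2)
    with * show ?thesis by blast
  qed
  have "\<rho> E = \<rho>' E" if E: "E \<in> ?G" for E
  proof -
    obtain \<A> where \<A>: "countable \<A>" "\<A> \<subseteq> P" "E \<subseteq> \<Union>\<A>"
      using E by (rule sigma_ring_hull_covered)
    show ?thesis
    proof (cases "\<A> = {}")
      case True
      with \<A> show ?thesis using \<rho> \<rho>' by (simp add: sigma_ring_measure_empty)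
    next
      case False
      define C where "C = from_nat_into \<A>"
      have C: "C n \<in> P" for n
        using \<A> False unfolding C_def by (meson from_nat_into subsetD)
      have "range C = \<A>"
        unfolding C_def using \<A> False by (simp add: range_from_nat_into)
      define D where "D n = E \<inter> disjointed C n" for n
      have D: "D n \<in> ?G" for n
        unfolding D_def disjointed_def using E C
        by (intro sigma_ring_Int G sigma_ring_Diff sigma_ring_UN) (auto simp: PG)
      have "disjoint_family D"
        using disjoint_family_disjointed[of C] unfolding D_def disjoint_family_on_def by blast
      have "(\<Union>n. D n) = E"
        using \<A> \<open>range C = \<A>\<close> UN_disjointed_eq[of C] unfolding D_def by auto
      have "\<rho> (D n) = \<rho>' (D n)" for n
        using disjointed_subset[of C n] by (intro local[OF C D]) (auto simp: D_def)
      then show ?thesis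
        using sigma_ring_measure_suminf[OF \<rho> G D \<open>disjoint_family D\<close>]
          sigma_ring_measure_suminf[OF \<rho>' G D \<open>disjoint_family D\<close>] \<open>(\<Union>n. D n) = E\<close> by simp
    qed
  qed
  moreover have "\<rho> \<in> extensional ?G" "\<rho>' \<in> extensional ?G"
    using \<rho> \<rho>' by (auto simp: sigma_ring_measure_def)
  ultimately show ?thesis by (intro extensionalityI)
qed

definition infinite_extension :: "'a set set \<Rightarrow> 'a set set \<Rightarrow> ('a set \<Rightarrow> ennreal) \<Rightarrow> 'a set \<Rightarrow> ennreal"
  where "infinite_extension J R \<mu> = restrict (\<lambda>E. if E \<in> J then \<mu> E else \<infinity>) R"

text \<open>A disjoint union lies in the ideal if and only if all its parts do: the ideal is closed under
  countable unions and under measurable subsets. So outside the ideal both sides of the additivity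
  equation are infinite.\<close>

lemma sigma_ring_measure_infinite_extension:
  assumes J: "sigma_ideal J R" and \<mu>: "sigma_ring_measure J \<mu>"
  shows "sigma_ring_measure R (infinite_extension J R \<mu>)"
proof -
  let ?\<mu> = "infinite_extension J R \<mu>"
  have ring: "sigma_ring J" and JR: "J \<subseteq> R"
    using J by (auto simp: sigma_ideal_def)
  have "{} \<in> J" using ring by (rule sigma_ring_empty)
  then have "positive R ?\<mu>"
    using sigma_ring_measure_empty[OF \<mu>] JR
    by (auto simp: positive_def infinite_extension_def)
  moreover have "countably_additive R ?\<mu>"
  proof (rule countably_additiveI)
    fix A :: "nat \<Rightarrow> 'a set"
    assume A: "range A \<subseteq> R" "disjoint_family A" "(\<Union>i. A i) \<in> R"
    show "(\<Sum>i. ?\<mu> (A i)) = ?\<mu> (\<Union>i. A i)"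
    proof (cases "\<forall>i. A i \<in> J")
      case True
      then have "(\<Union>i. A i) \<in> J" using ring by (intro sigma_ring_UN) auto
      with True A show ?thesis
        using sigma_ring_measure_suminf[OF \<mu> ring _ A(2)]
        by (auto simp: infinite_extension_def range_subsetD)
    next
      case False
      then obtain i where i: "A i \<notin> J" by blast
      have "(\<Union>i. A i) \<notin> J"
      proof
        assume "(\<Union>i. A i) \<in> J"
        moreover have "A i \<in> R" "A i \<subseteq> (\<Union>i. A i)" using A(1) by auto
        ultimately have "A i \<in> J" using J unfolding sigma_ideal_def by meson
        with i show False ..
      qed
      moreover have "?\<mu> (A i) \<le> (\<Sum>i. ?\<mu> (A i))"
        using sum_le_suminf[of "\<lambda>i. ?\<mu> (A i)" "{i}"] by (simp add: summableI)
      then have "(\<Sum>i. ?\<mu> (A i)) = \<infinity>"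
        using i A by (auto simp: infinite_extension_def top_unique range_subsetD)
      ultimately show ?thesis
        using A by (simp add: infinite_extension_def)
    qed
  qed
  ultimately show ?thesis
    by (simp add: sigma_ring_measure_def infinite_extension_def)
qed

section \<open>Sigma-finite sets\<close>

lemma sigma_finite_sets_iff:
  assumes \<mu>: "sigma_ring_measure R \<mu>" and R: "sigma_ring R"
  shows "E \<in> sigma_finite_sets R \<mu> \<longleftrightarrow>
    E \<in> R \<and> (\<exists>\<A>. countable \<A> \<and> \<A> \<subseteq> finite_measure_sets R \<mu> \<and> E \<subseteq> \<Union>\<A>)"
proof
  assume "E \<in> sigma_finite_sets R \<mu>"
  then obtain \<A> where \<A>: "countable \<A>" "\<A> \<subseteq> finite_measure_sets R \<mu>" "E = \<Union>\<A>"
    by (auto simp: sigma_finite_sets_def)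
  then have "E \<in> R"
    using R by (auto simp: finite_measure_sets_def intro!: sigma_ring_Union)
  with \<A> show "E \<in> R \<and> (\<exists>\<A>. countable \<A> \<and> \<A> \<subseteq> finite_measure_sets R \<mu> \<and> E \<subseteq> \<Union>\<A>)"
    by blast
next
  assume "E \<in> R \<and> (\<exists>\<A>. countable \<A> \<and> \<A> \<subseteq> finite_measure_sets R \<mu> \<and> E \<subseteq> \<Union>\<A>)"
  then obtain \<A> where E: "E \<in> R"
    and \<A>: "countable \<A>" "\<A> \<subseteq> finite_measure_sets R \<mu>" "E \<subseteq> \<Union>\<A>" by blast
  have "E \<inter> A \<in> finite_measure_sets R \<mu>" if "A \<in> \<A>" for A
  proof -
    have A: "A \<in> R" "\<mu> A < \<infinity>"
      using that \<A> by (auto simp: finite_measure_sets_def)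
    then have EA: "E \<inter> A \<in> R"
      using R E by (simp add: sigma_ring_Int)
    then show ?thesis
      using sigma_ring_measure_mono[OF \<mu> R EA A(1)] A by (auto simp: finite_measure_sets_def)
  qed
  then have "countable ((\<lambda>A. E \<inter> A) ` \<A>)" "(\<lambda>A. E \<inter> A) ` \<A> \<subseteq> finite_measure_sets R \<mu>"
    "E = \<Union>((\<lambda>A. E \<inter> A) ` \<A>)"
    using \<A> by auto
  then show "E \<in> sigma_finite_sets R \<mu>"
    unfolding sigma_finite_sets_def by blast
qed

lemma finite_measure_sets_subset_sigma_finite_sets:
  "finite_measure_sets R \<mu> \<subseteq> sigma_finite_sets R \<mu>"
proof
  fix A assume "A \<in> finite_measure_sets R \<mu>"
  then show "A \<in> sigma_finite_sets R \<mu>"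
    unfolding sigma_finite_sets_def by (intro CollectI exI[of _ "{A}"]) auto
qed

lemma sigma_ideal_sigma_finite_sets:
  assumes \<mu>: "sigma_ring_measure R \<mu>" and R: "sigma_ring R"
  shows "sigma_ideal (sigma_finite_sets R \<mu>) R"
proof -
  let ?J = "sigma_finite_sets R \<mu>"
  have ideal: "F \<in> ?J" if "E \<in> ?J" "F \<in> R" "F \<subseteq> E" for E F
    using that sigma_finite_sets_iff[OF assms] by (meson subset_trans)
  have JR: "?J \<subseteq> R"
    using sigma_finite_sets_iff[OF assms] by blast
  have "sigma_ring ?J"
    unfolding sigma_ring_def
  proof (intro conjI ballI allI impI)
    show "{} \<in> ?J"
      unfolding sigma_finite_sets_def by (intro CollectI exI[of _ "{}"]) auto
  next
    fix A B assume "A \<in> ?J" "B \<in> ?J"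
    then show "A - B \<in> ?J"
      using ideal[of A "A - B"] sigma_ring_Diff[OF R] JR by blast
  next
    fix \<E> assume \<E>: "countable \<E> \<and> \<E> \<subseteq> ?J"
    then obtain f where f: "\<forall>E\<in>\<E>. countable (f E) \<and> f E \<subseteq> finite_measure_sets R \<mu> \<and> E = \<Union>(f E)"
      unfolding sigma_finite_sets_def subset_iff mem_Collect_eq by metis
    have "countable (\<Union>(f ` \<E>))"
      using f \<E> by (intro countable_UN) auto
    moreover have "\<Union>(f ` \<E>) \<subseteq> finite_measure_sets R \<mu>"
      using f by blast
    moreover have "\<Union>\<E> = \<Union>(\<Union>(f ` \<E>))"
    proof -
      have "\<Union>\<E> = (\<Union>E\<in>\<E>. \<Union>(f E))"
        using f by (metis (no_types, lifting) SUP_cong image_ident)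
      then show ?thesis by blast
    qed
    ultimately show "\<Union>\<E> \<in> ?J"
      unfolding sigma_finite_sets_def by blast
  qed
  with ideal JR show ?thesis
    unfolding sigma_ideal_def by blast
qed

text \<open>Rectangles with \<open>\<sigma>\<close>-finite sides are countable unions of rectangles with sides of finite
  measure.\<close>

lemma prod_sigma_ring_sigma_finite_sets:
  "prod_sigma_ring (sigma_finite_sets R \<mu>) (sigma_finite_sets Q \<nu>) =
    sigma_ring hull {A \<times> B |A B. A \<in> finite_measure_sets R \<mu> \<and> B \<in> finite_measure_sets Q \<nu>}"
    (is "?G = ?H")
proof
  show "?G \<subseteq> ?H"
  proof (rule prod_sigma_ring_minimal)
    fix A B assume "A \<in> sigma_finite_sets R \<mu>" "B \<in> sigma_finite_sets Q \<nu>"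
    then obtain \<A> \<B> where \<A>: "countable \<A>" "\<A> \<subseteq> finite_measure_sets R \<mu>" "A = \<Union>\<A>"
      and \<B>: "countable \<B>" "\<B> \<subseteq> finite_measure_sets Q \<nu>" "B = \<Union>\<B>"
      unfolding sigma_finite_sets_def by blast
    have "(\<Union>(X, Y)\<in>\<A> \<times> \<B>. X \<times> Y) \<in> ?H"
      using \<A> \<B> by (intro sigma_ring_UN sigma_ring_hull) (auto intro!: hull_inc)
    moreover have "A \<times> B = (\<Union>(X, Y)\<in>\<A> \<times> \<B>. X \<times> Y)"
      using \<A> \<B> by auto
    ultimately show "A \<times> B \<in> ?H" by (simp only:)
  qed (rule sigma_ring_hull)
  show "?H \<subseteq> ?G"
    unfolding prod_sigma_ring_def
    using finite_measure_sets_subset_sigma_finite_sets[of R \<mu>]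
      finite_measure_sets_subset_sigma_finite_sets[of Q \<nu>]
    by (intro hull_mono) blast
qed

section \<open>The classical product of the sigma-finite components\<close>

definition locally_measurable_sets :: "'a set \<Rightarrow> 'a set set \<Rightarrow> 'a set set" where
  "locally_measurable_sets S R = {A. A \<subseteq> S \<and> (\<forall>F\<in>R. A \<inter> F \<in> R)}"

lemma sigma_algebra_locally_measurable_sets:
  assumes R: "sigma_ring R" "R \<subseteq> Pow S"
  shows "sigma_algebra S (locally_measurable_sets S R)"
  unfolding sigma_algebra_iff2
proof (intro conjI ballI allI impI)
  show "locally_measurable_sets S R \<subseteq> Pow S" "{} \<in> locally_measurable_sets S R"
    using R by (auto simp: locally_measurable_sets_def sigma_ring_empty)
next
  fix A assume A: "A \<in> locally_measurable_sets S R"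
  have "(S - A) \<inter> F \<in> R" if "F \<in> R" for F
  proof -
    have "(S - A) \<inter> F = F - (A \<inter> F)" using that R by blast
    with that A R show ?thesis
      by (simp add: locally_measurable_sets_def sigma_ring_Diff)
  qed
  then show "S - A \<in> locally_measurable_sets S R"
    by (auto simp: locally_measurable_sets_def)
next
  fix A :: "nat \<Rightarrow> 'a set" assume "range A \<subseteq> locally_measurable_sets S R"
  then have "A i \<subseteq> S" "F \<in> R \<Longrightarrow> A i \<inter> F \<in> R" for i F
    by (auto simp: locally_measurable_sets_def)
  moreover from this have "(\<Union>i. A i \<inter> F) \<in> R" if "F \<in> R" for F
    using R(1) that by (intro sigma_ring_UN) auto
  ultimately show "(\<Union>i. A i) \<in> locally_measurable_sets S R"
    unfolding locally_measurable_sets_def by (simp add: UN_subset_iff)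
qed

lemma sigma_ideal_locally_measurable_sets:
  assumes "sigma_ring R" "R \<subseteq> Pow S"
  shows "sigma_ideal R (locally_measurable_sets S R)"
  unfolding sigma_ideal_def
proof (intro conjI ballI impI)
  fix E F assume "E \<in> R" "F \<in> locally_measurable_sets S R" "F \<subseteq> E"
  then show "F \<in> R"
    unfolding locally_measurable_sets_def by (metis (mono_tags, lifting) Int_absorb2 mem_Collect_eq)
qed (use assms in \<open>auto simp: locally_measurable_sets_def sigma_ring_Int\<close>)

text \<open>Any \<open>\<sigma>\<close>-ring is an ideal in the \<open>\<sigma>\<close>-algebra of its locally measurable sets, so every measure
  on a \<open>\<sigma>\<close>-ring is the restriction of a measure on a \<open>\<sigma>\<close>-algebra.\<close>

lemma sigma_ring_measure_extends:
  assumes "sigma_ring_measure_space S R \<mu>"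
  obtains M where "space M = S" "R \<subseteq> sets M" "\<And>A. A \<in> R \<Longrightarrow> emeasure M A = \<mu> A"
proof -
  have R: "sigma_ring R" "R \<subseteq> Pow S" and \<mu>: "sigma_ring_measure R \<mu>"
    using assms by (auto simp: sigma_ring_measure_space_def)
  let ?L = "locally_measurable_sets S R"
  let ?\<mu> = "infinite_extension R ?L \<mu>"
  interpret L: sigma_algebra S ?L
    using R by (rule sigma_algebra_locally_measurable_sets)
  have ideal: "sigma_ideal R ?L"
    using R by (rule sigma_ideal_locally_measurable_sets)
  then have RL: "R \<subseteq> ?L" by (simp add: sigma_ideal_def)
  have ext: "positive ?L ?\<mu>" "countably_additive ?L ?\<mu>"
    using sigma_ring_measure_infinite_extension[OF ideal \<mu>] by (auto simp: sigma_ring_measure_def)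
  show thesis
  proof
    show "space (measure_of S ?L ?\<mu>) = S" by simp
    show "R \<subseteq> sets (measure_of S ?L ?\<mu>)" using RL by simp
    show "emeasure (measure_of S ?L ?\<mu>) A = \<mu> A" if "A \<in> R" for A
      using emeasure_measure_of_sigma[OF L.sigma_algebra_axioms ext, of A] that RL
      by (auto simp: infinite_extension_def)
  qed
qed

text \<open>The value at \<open>E\<close> is \<open>\<integral> \<nu>(E\<^sub>x) d\<mu>(x)\<close>. On sets inside a strip \<open>S \<times> B\<close> with \<open>B\<close> a \<open>\<sigma>\<close>-finite set
  it agrees with the product of \<open>\<mu>\<close> and the \<open>\<sigma>\<close>-finite measure \<open>Y \<mapsto> \<nu>(B \<inter> Y)\<close>, and inherits
  \<open>\<sigma>\<close>-additivity from it. As the formula does not mention \<open>B\<close>, the strips fit together.\<close>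

lemma halmos_product_measure_exists:
  assumes S: "sigma_ring_measure_space S \<SS> \<mu>" and T: "sigma_ring_measure_space T \<TT> \<nu>"
  obtains \<rho> where
    "sigma_ring_measure (prod_sigma_ring (sigma_finite_sets \<SS> \<mu>) (sigma_finite_sets \<TT> \<nu>)) \<rho>"
    "\<And>A B. A \<in> sigma_finite_sets \<SS> \<mu> \<Longrightarrow> B \<in> sigma_finite_sets \<TT> \<nu> \<Longrightarrow> \<rho> (A \<times> B) = \<mu> A * \<nu> B"
proof -
  let ?J = "sigma_finite_sets \<SS> \<mu>" and ?K = "sigma_finite_sets \<TT> \<nu>"
  let ?G = "prod_sigma_ring ?J ?K"
  obtain M where M: "space M = S" "\<SS> \<subseteq> sets M" "\<And>A. A \<in> \<SS> \<Longrightarrow> emeasure M A = \<mu> A"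
    using sigma_ring_measure_extends[OF S] by blast
  obtain N where N: "space N = T" "\<TT> \<subseteq> sets N" "\<And>B. B \<in> \<TT> \<Longrightarrow> emeasure N B = \<nu> B"
    using sigma_ring_measure_extends[OF T] by blast
  have J: "sigma_ideal ?J \<SS>" and K: "sigma_ideal ?K \<TT>"
    using S T by (auto simp: sigma_ring_measure_space_def intro: sigma_ideal_sigma_finite_sets)
  have JM: "?J \<subseteq> sets M" and KN: "?K \<subseteq> sets N"
    using J K M N by (auto simp: sigma_ideal_def)
  have "sigma_ring (sets (M \<Otimes>\<^sub>M N))"
    unfolding sigma_ring_def by (auto intro: sets.countable_Union)
  then have G: "?G \<subseteq> sets (M \<Otimes>\<^sub>M N)"
    using JM KN by (intro prod_sigma_ring_minimal) auto
  \<comment> \<open>A density, unlike a restriction of the space, keeps the \<open>\<sigma>\<close>-algebra independent of \<open>B\<close>.\<close>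
  define strip where "strip B = M \<Otimes>\<^sub>M density N (indicator B)" for B
  have sets_strip: "sets (strip B) = sets (M \<Otimes>\<^sub>M N)" for B
    unfolding strip_def by (intro sets_pair_measure_cong) auto
  have sigma_finite: "sigma_finite_measure (density N (indicator B))" if BK: "B \<in> ?K" for B
  proof (rule sigma_finite_measure.intro)
    obtain \<B> where \<B>: "countable \<B>" "\<B> \<subseteq> finite_measure_sets \<TT> \<nu>" "B = \<Union>\<B>"
      using BK unfolding sigma_finite_sets_def by blast
    have B: "B \<in> sets N" using BK KN by blast
    have *: "X \<in> sets N" "emeasure N X < \<infinity>" if "X \<in> \<B>" for X
      using that \<B> N by (auto simp: finite_measure_sets_def)
    have "emeasure N (B \<inter> X) < \<infinity>" if "X \<in> \<B>" for X
      using emeasure_mono[of "B \<inter> X" X N] *[OF that] by auto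
    then have density: "emeasure (density N (indicator B)) X \<noteq> top" if "X \<in> \<B>" for X
      using *(1)[OF that] that by (simp add: emeasure_restricted B less_top)
    \<comment> \<open>The complement of \<open>B\<close> is a null set of the restricted measure, so the countable cover of
      \<open>B\<close> extends to the whole space.\<close>
    have co: "space N - B \<in> sets N" using B by simp
    then have "emeasure (density N (indicator B)) (space N - B) = 0"
      by (simp add: emeasure_restricted B)
    moreover have "\<Union>(insert (space N - B) \<B>) = space N"
      using \<B>(3) sets.sets_into_space[OF B] by blast
    moreover have "insert (space N - B) \<B> \<subseteq> sets N" "countable (insert (space N - B) \<B>)"
      using co *(1) \<B>(1) by auto
    ultimately show "\<exists>A. countable A \<and> A \<subseteq> sets (density N (indicator B)) \<and>
        \<Union>A = space (density N (indicator B)) \<and> (\<forall>a\<in>A. emeasure (density N (indicator B)) a \<noteq> \<infinity>)"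
      by (intro exI[of _ "insert (space N - B) \<B>"]) (simp add: density)
  qed
  define \<rho> where "\<rho> = restrict (\<lambda>E. \<integral>\<^sup>+x. emeasure N (Pair x -` E) \<partial>M) ?G"
  have \<rho>_strip: "\<rho> E = emeasure (strip B) E" if E: "E \<in> ?G" "E \<subseteq> UNIV \<times> B" and B: "B \<in> ?K" for E B
  proof -
    have "emeasure (strip B) E = (\<integral>\<^sup>+x. emeasure (density N (indicator B)) (Pair x -` E) \<partial>M)"
      unfolding strip_def using E G sets_strip[of B]
      by (intro sigma_finite_measure.emeasure_pair_measure_alt sigma_finite B) (auto simp: strip_def)
    also have "\<dots> = (\<integral>\<^sup>+x. emeasure N (Pair x -` E) \<partial>M)"
    proof (intro nn_integral_cong)
      fix x
      have "Pair x -` E \<in> sets N" using E G by (intro sets_Pair1) auto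
      moreover have "B \<inter> Pair x -` E = Pair x -` E" using E by auto
      ultimately show "emeasure (density N (indicator B)) (Pair x -` E) = emeasure N (Pair x -` E)"
        using B KN by (subst emeasure_restricted) auto
    qed
    finally show ?thesis using E by (simp add: \<rho>_def)
  qed
  \<comment> \<open>Applied to the union of a disjoint sequence, this puts the whole sequence into one strip.\<close>
  have in_strip: "\<exists>B\<in>?K. E \<subseteq> UNIV \<times> B" if EG: "E \<in> ?G" for E
  proof -
    obtain \<A> where \<A>: "countable \<A>" "\<A> \<subseteq> {A \<times> B |A B. A \<in> ?J \<and> B \<in> ?K}" "E \<subseteq> \<Union>\<A>"
      using EG unfolding prod_sigma_ring_def by (rule sigma_ring_hull_covered)
    have "\<forall>C\<in>\<A>. \<exists>B. B \<in> ?K \<and> C \<subseteq> UNIV \<times> B"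
      using \<A>(2) by blast
    then obtain b where b: "\<forall>C\<in>\<A>. b C \<in> ?K \<and> C \<subseteq> UNIV \<times> b C"
      by metis
    have "(\<Union>C\<in>\<A>. b C) \<in> ?K"
      using b K \<A> by (intro sigma_ring_UN) (auto simp: sigma_ideal_def)
    moreover have "E \<subseteq> UNIV \<times> (\<Union>C\<in>\<A>. b C)"
      using b \<A> by fastforce
    ultimately show ?thesis by blast
  qed
  show thesis
  proof
    have "{} \<in> ?G" by (rule sigma_ring_empty[OF sigma_ring_prod_sigma_ring])
    then have "positive ?G \<rho>"
      by (simp add: positive_def \<rho>_def)
    moreover have "countably_additive ?G \<rho>"
    proof (rule countably_additiveI)
      fix E :: "nat \<Rightarrow> ('a \<times> 'b) set"
      assume E: "range E \<subseteq> ?G" "disjoint_family E" "(\<Union>i. E i) \<in> ?G"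
      obtain B where B: "B \<in> ?K" "(\<Union>i. E i) \<subseteq> UNIV \<times> B"
        using in_strip[OF E(3)] by blast
      then have "\<rho> (\<Union>i. E i) = emeasure (strip B) (\<Union>i. E i)" "\<And>i. \<rho> (E i) = emeasure (strip B) (E i)"
        using E by (auto intro!: \<rho>_strip)
      moreover have "range E \<subseteq> sets (strip B)"
        using E G sets_strip by blast
      ultimately show "(\<Sum>i. \<rho> (E i)) = \<rho> (\<Union>i. E i)"
        using suminf_emeasure[OF _ E(2), of "strip B"] by simp
    qed
    ultimately show "sigma_ring_measure ?G \<rho>"
      by (simp add: sigma_ring_measure_def \<rho>_def)
  next
    fix A B assume AB: "A \<in> ?J" "B \<in> ?K"
    then have "A \<in> \<SS>" "B \<in> \<TT>" using J K by (auto simp: sigma_ideal_def)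
    have "\<rho> (A \<times> B) = emeasure (strip B) (A \<times> B)"
      using AB by (intro \<rho>_strip Times_in_prod_sigma_ring) auto
    also have "\<dots> = emeasure M A * emeasure (density N (indicator B)) B"
      unfolding strip_def using AB JM KN
      by (intro sigma_finite_measure.emeasure_pair_measure_Times sigma_finite) auto
    also have "\<dots> = \<mu> A * \<nu> B"
      using M N \<open>A \<in> \<SS>\<close> \<open>B \<in> \<TT>\<close> by (subst emeasure_restricted) auto
    finally show "\<rho> (A \<times> B) = \<mu> A * \<nu> B" .
  qed
qed

lemma finite_measure_sets_Int:
  assumes "sigma_ring_measure R \<mu>" "sigma_ring R"
    and "A \<in> finite_measure_sets R \<mu>" "B \<in> finite_measure_sets R \<mu>"
  shows "A \<inter> B \<in> finite_measure_sets R \<mu>"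
  using assms sigma_ring_measure_mono[OF assms(1,2), of "A \<inter> B" A] sigma_ring_Int[OF assms(2), of A B]
  by (auto simp: finite_measure_sets_def)

text \<open>The finite values that the uniqueness lemma asks for on the generators are the reason to use
  rectangles with sides of finite measure, not of \<open>\<sigma>\<close>-finite measure.\<close>

lemma product_measure_unique:
  assumes \<mu>: "sigma_ring \<SS>" "sigma_ring_measure \<SS> \<mu>"
    and \<nu>: "sigma_ring \<TT>" "sigma_ring_measure \<TT> \<nu>"
    and G: "G = sigma_ring hull
      {A \<times> B |A B. A \<in> finite_measure_sets \<SS> \<mu> \<and> B \<in> finite_measure_sets \<TT> \<nu>}"
    and \<rho>: "sigma_ring_measure G \<rho>"
      "\<And>A B. A \<in> finite_measure_sets \<SS> \<mu> \<Longrightarrow> B \<in> finite_measure_sets \<TT> \<nu> \<Longrightarrow>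
        \<rho> (A \<times> B) = \<mu> A * \<nu> B"
    and \<rho>': "sigma_ring_measure G \<rho>'"
      "\<And>A B. A \<in> finite_measure_sets \<SS> \<mu> \<Longrightarrow> B \<in> finite_measure_sets \<TT> \<nu> \<Longrightarrow>
        \<rho>' (A \<times> B) = \<mu> A * \<nu> B"
  shows "\<rho> = \<rho>'"
proof -
  let ?P = "{A \<times> B |A B. A \<in> finite_measure_sets \<SS> \<mu> \<and> B \<in> finite_measure_sets \<TT> \<nu>}"
  have "Int_stable ?P"
  proof (rule Int_stableI)
    fix C D assume "C \<in> ?P" "D \<in> ?P"
    then obtain A B A' B' where CD: "C = A \<times> B" "D = A' \<times> B'"
      and *: "A \<in> finite_measure_sets \<SS> \<mu>" "B \<in> finite_measure_sets \<TT> \<nu>"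
      "A' \<in> finite_measure_sets \<SS> \<mu>" "B' \<in> finite_measure_sets \<TT> \<nu>" by blast
    have "C \<inter> D = (A \<inter> A') \<times> (B \<inter> B')"
      unfolding CD by (rule Times_Int_Times)
    moreover have "A \<inter> A' \<in> finite_measure_sets \<SS> \<mu>" "B \<inter> B' \<in> finite_measure_sets \<TT> \<nu>"
      using * \<mu> \<nu> by (auto intro: finite_measure_sets_Int)
    ultimately show "C \<inter> D \<in> ?P" by blast
  qed
  then show ?thesis
    using \<rho>(1)[unfolded G] \<rho>'(1)[unfolded G]
  proof (rule sigma_ring_measure_unique)
    fix C assume "C \<in> ?P"
    then obtain A B where C: "C = A \<times> B"
      "A \<in> finite_measure_sets \<SS> \<mu>" "B \<in> finite_measure_sets \<TT> \<nu>" by blast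
    then show "\<rho> C = \<rho>' C"
      by (simp add: \<rho> \<rho>')
    show "\<rho> C < \<infinity>"
      using C by (simp add: \<rho> finite_measure_sets_def ennreal_mult_less_top)
  qed
qed

section \<open>The product of arbitrary measures\<close>

text \<open>Measurable sets that are not \<open>\<sigma>\<close>-finite have infinite measure.\<close>

lemma sigma_finite_component_determines_measure:
  assumes "sigma_ring_measure R \<rho>" "sigma_ring_measure R \<rho>'"
    and "sigma_finite_component R \<rho> = sigma_finite_component R \<rho>'"
  shows "\<rho> = \<rho>'"
proof (rule extensionalityI)
  show "\<rho> \<in> extensional R" "\<rho>' \<in> extensional R"
    using assms by (auto simp: sigma_ring_measure_def)
next
  fix E assume E: "E \<in> R"
  let ?J = "sigma_finite_sets R \<rho>"
  have J: "?J = sigma_finite_sets R \<rho>'" and eq: "restrict \<rho> ?J = restrict \<rho>' ?J"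
    using assms by (auto simp: sigma_finite_component_def)
  show "\<rho> E = \<rho>' E"
  proof (cases "E \<in> ?J")
    case True
    then show ?thesis using fun_cong[OF eq, of E] by simp
  next
    case False
    then have "E \<notin> finite_measure_sets R \<rho>" "E \<notin> finite_measure_sets R \<rho>'"
      using J finite_measure_sets_subset_sigma_finite_sets by blast+
    then show ?thesis
      using E by (simp add: finite_measure_sets_def not_less top_unique)
  qed
qed

lemma sigma_ring_measure_restrict:
  assumes "sigma_ring_measure R \<mu>" "sigma_ring J" "J \<subseteq> R"
  shows "sigma_ring_measure J (restrict \<mu> J)"
  using assms sigma_ring_empty[of J]
  by (auto simp: sigma_ring_measure_def positive_def countably_additive_def range_subsetD)

theorem corollary2p5:
  fixes S :: "'a set" and \<SS> :: "'a set set" and \<mu> :: "'a set \<Rightarrow> ennreal"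
    and T :: "'b set" and \<TT> :: "'b set set" and \<nu> :: "'b set \<Rightarrow> ennreal"
  assumes "sigma_ring_measure_space S \<SS> \<mu>"
    and "sigma_ring_measure_space T \<TT> \<nu>"
  shows "\<exists>\<rho>.
    (sigma_ring_measure_space (S \<times> T) (prod_sigma_ring \<SS> \<TT>) \<rho> \<and>
     sigma_finite_component (prod_sigma_ring \<SS> \<TT>) \<rho> =
       halmos_product (sigma_finite_component \<SS> \<mu>) (sigma_finite_component \<TT> \<nu>)) \<and>
    (\<forall>\<rho>'. sigma_ring_measure_space (S \<times> T) (prod_sigma_ring \<SS> \<TT>) \<rho>' \<and>
          sigma_finite_component (prod_sigma_ring \<SS> \<TT>) \<rho>' =
            halmos_product (sigma_finite_component \<SS> \<mu>) (sigma_finite_component \<TT> \<nu>)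
          \<longrightarrow> \<rho>' = \<rho>) \<and>
    ((\<forall>A\<in>finite_measure_sets \<SS> \<mu>. \<forall>B\<in>finite_measure_sets \<TT> \<nu>. \<rho> (A \<times> B) = \<mu> A * \<nu> B) \<and>
     sigma_finite_sets (prod_sigma_ring \<SS> \<TT>) \<rho> =
       sigma_ring hull {A \<times> B |A B. A \<in> finite_measure_sets \<SS> \<mu> \<and> B \<in> finite_measure_sets \<TT> \<nu>}) \<and>
    (\<forall>\<rho>'. sigma_ring_measure_space (S \<times> T) (prod_sigma_ring \<SS> \<TT>) \<rho>' \<and>
          (\<forall>A\<in>finite_measure_sets \<SS> \<mu>. \<forall>B\<in>finite_measure_sets \<TT> \<nu>. \<rho>' (A \<times> B) = \<mu> A * \<nu> B) \<and>
          sigma_finite_sets (prod_sigma_ring \<SS> \<TT>) \<rho>' =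
            sigma_ring hull {A \<times> B |A B. A \<in> finite_measure_sets \<SS> \<mu> \<and> B \<in> finite_measure_sets \<TT> \<nu>}
          \<longrightarrow> \<rho>' = \<rho>)"
proof -
  let ?R = "prod_sigma_ring \<SS> \<TT>"
  let ?J = "sigma_finite_sets \<SS> \<mu>" and ?K = "sigma_finite_sets \<TT> \<nu>"
  let ?FS = "finite_measure_sets \<SS> \<mu>" and ?FT = "finite_measure_sets \<TT> \<nu>"
  let ?P = "{A \<times> B |A B. A \<in> ?FS \<and> B \<in> ?FT}"
  let ?product = "\<lambda>\<rho>. \<forall>A\<in>?FS. \<forall>B\<in>?FT. \<rho> (A \<times> B) = \<mu> A * \<nu> B"
  define G where "G = prod_sigma_ring ?J ?K"
  have S: "S \<noteq> {}" "\<SS> \<subseteq> Pow S" "sigma_ring \<SS>" "sigma_ring_measure \<SS> \<mu>"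
    and T: "T \<noteq> {}" "\<TT> \<subseteq> Pow T" "sigma_ring \<TT>" "sigma_ring_measure \<TT> \<nu>"
    using assms by (auto simp: sigma_ring_measure_space_def)
  have G_eq: "G = sigma_ring hull ?P"
    unfolding G_def by (rule prod_sigma_ring_sigma_finite_sets)
  have ring: "sigma_ring ?R" by (rule sigma_ring_prod_sigma_ring)
  have ideal: "sigma_ideal G ?R"
    unfolding G_def using S T
    by (intro sigma_ideal_prod_sigma_ring sigma_ideal_sigma_finite_sets)
  then have ringG: "sigma_ring G" and GR: "G \<subseteq> ?R" by (auto simp: sigma_ideal_def)
  have PG: "A \<times> B \<in> G" if "A \<in> ?FS" "B \<in> ?FT" for A B
    unfolding G_eq using that by (intro hull_inc) blast
  have FJ: "?FS \<subseteq> ?J" "?FT \<subseteq> ?K"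
    by (auto intro: finite_measure_sets_subset_sigma_finite_sets[THEN subsetD])
  \<comment> \<open>The rectangles in the classical product have \<open>\<sigma>\<close>-finite sides; those with sides of finite
    measure already pin it down.\<close>
  have unique: "\<rho>1 = \<rho>2"
    if "sigma_ring_measure G \<rho>1" "?product \<rho>1" "sigma_ring_measure G \<rho>2" "?product \<rho>2" for \<rho>1 \<rho>2
    using that by (intro product_measure_unique[OF S(3,4) T(3,4) G_eq]) auto

  obtain \<rho>0 where \<rho>0: "sigma_ring_measure G \<rho>0"
    "\<And>A B. A \<in> ?J \<Longrightarrow> B \<in> ?K \<Longrightarrow> \<rho>0 (A \<times> B) = \<mu> A * \<nu> B"
    using halmos_product_measure_exists[OF assms] unfolding G_def by blast
  have product0: "?product \<rho>0"
    using \<rho>0(2) FJ by blast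
  have halmos: "halmos_product (sigma_finite_component \<SS> \<mu>) (sigma_finite_component \<TT> \<nu>) = (G, \<rho>0)"
  proof -
    have "(THE \<rho>. sigma_ring_measure G \<rho> \<and>
        (\<forall>A\<in>?J. \<forall>B\<in>?K. \<rho> (A \<times> B) = restrict \<mu> ?J A * restrict \<nu> ?K B)) = \<rho>0"
    proof (rule the_equality)
      fix \<rho> assume \<rho>: "sigma_ring_measure G \<rho> \<and>
        (\<forall>A\<in>?J. \<forall>B\<in>?K. \<rho> (A \<times> B) = restrict \<mu> ?J A * restrict \<nu> ?K B)"
      then have "?product \<rho>" using FJ by (auto simp: subset_iff)
      with \<rho> show "\<rho> = \<rho>0" using \<rho>0(1) product0 by (intro unique) auto
    qed (use \<rho>0 in auto)
    then show ?thesis by (simp add: sigma_finite_component_def G_def)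
  qed

  define \<rho> where "\<rho> = infinite_extension G ?R \<rho>0"
  have \<rho>: "sigma_ring_measure ?R \<rho>"
    unfolding \<rho>_def using ideal \<rho>0(1) by (rule sigma_ring_measure_infinite_extension)
  have \<rho>_G: "\<rho> E = \<rho>0 E" if "E \<in> G" for E
    using that GR by (auto simp: \<rho>_def infinite_extension_def)
  have product: "?product \<rho>"
    using product0 PG \<rho>_G by simp
  have "?R \<subseteq> Pow (S \<times> T)"
  proof (rule prod_sigma_ring_minimal)
    show "sigma_ring (Pow (S \<times> T))"
      unfolding sigma_ring_def by blast
    show "A \<times> B \<in> Pow (S \<times> T)" if "A \<in> \<SS>" "B \<in> \<TT>" for A B
      using S(2) T(2) that by blast
  qed
  with \<rho> ring S T have space: "sigma_ring_measure_space (S \<times> T) ?R \<rho>"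
    by (simp add: sigma_ring_measure_space_def)
  have sigma_finite: "sigma_finite_sets ?R \<rho> = G"
  proof
    have "finite_measure_sets ?R \<rho> \<subseteq> G"
      by (auto simp: finite_measure_sets_def \<rho>_def infinite_extension_def split: if_splits)
    then show "sigma_finite_sets ?R \<rho> \<subseteq> G"
      using sigma_ring_Union[OF ringG] unfolding sigma_finite_sets_def by blast
    have "?P \<subseteq> finite_measure_sets ?R \<rho>"
      using product PG GR by (auto simp: finite_measure_sets_def ennreal_mult_less_top)
    then have "?P \<subseteq> sigma_finite_sets ?R \<rho>"
      using finite_measure_sets_subset_sigma_finite_sets by blast
    then show "G \<subseteq> sigma_finite_sets ?R \<rho>"
      unfolding G_eq using sigma_ideal_sigma_finite_sets[OF \<rho> ring]
      by (intro hull_minimal) (auto simp: sigma_ideal_def)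
  qed
  have component: "sigma_finite_component ?R \<rho> = (G, \<rho>0)"
  proof -
    have "restrict \<rho> G = \<rho>0"
      using \<rho>0(1) \<rho>_G by (intro extensionalityI[of _ G]) (auto simp: sigma_ring_measure_def)
    then show ?thesis by (simp add: sigma_finite_component_def sigma_finite)
  qed
  have determined: "\<rho>' = \<rho>"
    if "sigma_ring_measure_space (S \<times> T) ?R \<rho>'" "sigma_finite_component ?R \<rho>' = (G, \<rho>0)" for \<rho>'
    using that component \<rho>
    by (intro sigma_finite_component_determines_measure[of ?R]) (auto simp: sigma_ring_measure_space_def)
  have determined': "\<rho>' = \<rho>"
    if \<rho>': "sigma_ring_measure_space (S \<times> T) ?R \<rho>'" "?product \<rho>'" "sigma_finite_sets ?R \<rho>' = G" for \<rho>'
  proof -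
    have "restrict \<rho>' G = \<rho>0"
    proof (rule unique)
      show "sigma_ring_measure G (restrict \<rho>' G)"
        using \<rho>' ringG GR by (intro sigma_ring_measure_restrict) (auto simp: sigma_ring_measure_space_def)
      show "?product (restrict \<rho>' G)"
        using \<rho>'(2) PG by simp
    qed (use \<rho>0 product0 in auto)
    with \<rho>' show ?thesis
      by (intro determined) (auto simp: sigma_finite_component_def)
  qed
  show ?thesis
    unfolding halmos G_eq[symmetric]
    using space component product sigma_finite determined determined' by blast
qed

end
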